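(* Let $\kappa\ge\omega$ be a cardinal and let $U$ be a uniform $\kappa$-complete ultrafilter over $\kappa$. If $U$ is a simple $P_{\mathbb{D}}$-point for a partial order $\mathbb{D}=(D,\le_D)$, then there is no $\subseteq$-increasing sequence $\langle D_i: i<\kappa\rangle$ of subsets of $D$ with $D=\bigcup_{i<\kappa}D_i$ such that each $D_i$ is $\kappa$-directed and not cofinal in $\mathbb{D}$.
   Context: $A\subseteq^*B$ means $A\setminus B$ is bounded in $\kappa$. An ultrafilter $U$ on $\kappa$ is a simple $P_{\mathbb{D}}$-point if there is $\mathcal{B}\subseteq U$ such that every $A\in U$ has some $B\in\mathcal{B}$ with $B\subseteq^*A$, and $(\mathcal{B},\supseteq^* )$ is order-isomorphic to $\mathbb{D}$. A subset $E\subseteq D$ is $\kappa$-directed if every subset of $E$ of size less than $\kappa$ has an upper bound in $E$; $E$ is cofinal in $\mathbb{D}$ if every element of $D$ is $\le_D$ some element of $E$. Uniform means every set in $U$ has cardinality $\kappa$. *)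

theory Defs
  imports Main
begin

unbundle cardinal_syntax

text \<open>
  A cardinal \<open>\<kappa>\<close> is a relation \<open>\<kappa> :: 'a rel\<close> satisfying \<open>Card_order \<kappa>\<close>. Its ordinals below
  \<open>\<kappa>\<close> are the elements of \<open>Field \<kappa>\<close>, and \<open>(a, b) \<in> \<kappa>\<close> is the non-strict order between them.
\<close>

definition ultrafilter_on :: "'a set \<Rightarrow> 'a set set \<Rightarrow> bool" where
  "ultrafilter_on X U \<longleftrightarrow>
     U \<subseteq> Pow X \<and> X \<in> U \<and> {} \<notin> U \<and>
     (\<forall>A\<in>U. \<forall>B\<in>U. A \<inter> B \<in> U) \<and>
     (\<forall>A\<in>U. \<forall>B. A \<subseteq> B \<and> B \<subseteq> X \<longrightarrow> B \<in> U) \<and>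
     (\<forall>A. A \<subseteq> X \<longrightarrow> A \<in> U \<or> X - A \<in> U)"

text \<open>The intersection with \<open>Field \<kappa>\<close> only matters for the empty family.\<close>

definition complete_filter :: "'a rel \<Rightarrow> 'a set set \<Rightarrow> bool" where
  "complete_filter \<kappa> U \<longleftrightarrow> (\<forall>F. F \<subseteq> U \<and> |F| <o \<kappa> \<longrightarrow> Field \<kappa> \<inter> \<Inter>F \<in> U)"

definition uniform_filter :: "'a rel \<Rightarrow> 'a set set \<Rightarrow> bool" where
  "uniform_filter \<kappa> U \<longleftrightarrow> (\<forall>A\<in>U. |A| =o \<kappa>)"

definition bounded_in :: "'a rel \<Rightarrow> 'a set \<Rightarrow> bool" where
  "bounded_in \<kappa> A \<longleftrightarrow> (\<exists>b\<in>Field \<kappa>. \<forall>a\<in>A. (a, b) \<in> \<kappa>)"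

definition almost_subset :: "'a rel \<Rightarrow> 'a set \<Rightarrow> 'a set \<Rightarrow> bool" where
  "almost_subset \<kappa> A B \<longleftrightarrow> bounded_in \<kappa> (A - B)"

definition order_isomorphic :: "'a set \<Rightarrow> 'a rel \<Rightarrow> 'b set \<Rightarrow> 'b rel \<Rightarrow> bool" where
  "order_isomorphic A r B s \<longleftrightarrow>
     (\<exists>f. bij_betw f A B \<and> (\<forall>x\<in>A. \<forall>y\<in>A. (x, y) \<in> r \<longleftrightarrow> (f x, f y) \<in> s))"

text \<open>
  The order on \<open>\<B>\<close> is reverse almost inclusion: \<open>X\<close> lies below \<open>Y\<close> iff \<open>Y \<subseteq>\<^sup>* X\<close>. It is
  in general only a preorder; \<open>\<B>\<close> is not quotiented, so an isomorphism with a partial order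
  forces distinct members of \<open>\<B>\<close> not to be almost equal.
\<close>

definition simple_P_point :: "'a rel \<Rightarrow> 'a set set \<Rightarrow> 'd set \<Rightarrow> 'd rel \<Rightarrow> bool" where
  "simple_P_point \<kappa> U D leD \<longleftrightarrow>
     (\<exists>\<B>. \<B> \<subseteq> U \<and>
          (\<forall>A\<in>U. \<exists>B\<in>\<B>. almost_subset \<kappa> B A) \<and>
          order_isomorphic \<B> {(X, Y). X \<in> \<B> \<and> Y \<in> \<B> \<and> almost_subset \<kappa> Y X} D leD)"

definition directed_for :: "'a rel \<Rightarrow> 'd rel \<Rightarrow> 'd set \<Rightarrow> bool" where
  "directed_for \<kappa> leD E \<longleftrightarrow>
     (\<forall>S. S \<subseteq> E \<and> |S| <o \<kappa> \<longrightarrow> (\<exists>e\<in>E. \<forall>s\<in>S. (s, e) \<in> leD))"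

text \<open>
  Unlike \<^const>\<open>cofinal\<close> from the library, which asks for strict upper bounds, this is the
  usual non-strict notion.
\<close>

definition cofinal_in :: "'d set \<Rightarrow> 'd rel \<Rightarrow> 'd set \<Rightarrow> bool" where
  "cofinal_in D leD E \<longleftrightarrow> E \<subseteq> D \<and> (\<forall>d\<in>D. \<exists>e\<in>E. (d, e) \<in> leD)"

end

theory Submission
  imports Defs
begin

text \<open>
  Pick \<open>B\<^sub>i = b (c i)\<close> in the base such that no element of \<open>D\<^sub>i\<close> lies above \<open>c i\<close>, and let
  \<open>f x\<close> be the least \<open>i\<close> with \<open>x \<notin> B\<^sub>i\<close> or \<open>i = x\<close>. Let \<open>N\<^sub>i\<close> be the set of those \<open>n\<close> whose
  fibre \<open>f\<^sup>-\<^sup>1(n)\<close> meets every \<open>b e\<close>, \<open>e \<in> D\<^sub>i\<close>, in an unbounded set. Directedness of \<open>D\<^sub>i\<close>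
  makes \<open>N\<^sub>i\<close> nonempty, and the \<open>N\<^sub>i\<close> decrease to the empty set. As \<open>\<kappa>\<close> is regular, some \<open>Z\<close>
  splits all the \<open>N\<^sub>i\<close>; but then neither \<open>f\<^sup>-\<^sup>1(Z)\<close> nor its complement almost contains a base set.
\<close>

section \<open>Elementary facts on the well-order \<open>\<kappa>\<close>, bounded sets and
  ultrafilters\<close>

lemma Card_order_least:
  assumes "Card_order \<kappa>" "S \<subseteq> Field \<kappa>" "S \<noteq> {}"
  obtains m where "m \<in> S" "\<forall>s\<in>S. (m, s) \<in> \<kappa>"
proof -
  interpret wo_rel \<kappa>
    using assms(1) by (simp add: wo_rel_def card_order_on_well_order_on)
  show thesis
    using that minim_in[OF assms(2,3)] minim_least[OF assms(2)] by blast
qed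

lemma Card_order_not_le_iff:
  assumes "Card_order \<kappa>" "a \<in> Field \<kappa>" "b \<in> Field \<kappa>"
  shows "(a, b) \<notin> \<kappa> \<longleftrightarrow> (b, a) \<in> \<kappa> \<and> a \<noteq> b"
proof -
  interpret wo_rel \<kappa>
    using assms(1) by (simp add: wo_rel_def card_order_on_well_order_on)
  show ?thesis
    using TOTALS REFL ANTISYM assms(2,3) unfolding refl_on_def antisym_def by blast
qed

lemma Card_order_le_trans:
  assumes "Card_order \<kappa>" "(a, b) \<in> \<kappa>" "(b, c) \<in> \<kappa>"
  shows "(a, c) \<in> \<kappa>"
proof -
  interpret wo_rel \<kappa>
    using assms(1) by (simp add: wo_rel_def card_order_on_well_order_on)
  show ?thesis
    using TRANS assms(2,3) by (blast dest: transD)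
qed

lemma bounded_in_mono: "bounded_in \<kappa> B \<Longrightarrow> A \<subseteq> B \<Longrightarrow> bounded_in \<kappa> A"
  unfolding bounded_in_def by blast

lemma bounded_in_Un:
  assumes "Card_order \<kappa>" "bounded_in \<kappa> A" "bounded_in \<kappa> B"
  shows "bounded_in \<kappa> (A \<union> B)"
proof -
  obtain a b where a: "a \<in> Field \<kappa>" "\<And>x. x \<in> A \<Longrightarrow> (x, a) \<in> \<kappa>"
    and b: "b \<in> Field \<kappa>" "\<And>x. x \<in> B \<Longrightarrow> (x, b) \<in> \<kappa>"
    using assms(2,3) unfolding bounded_in_def by auto
  have trans: "(x, z) \<in> \<kappa>" if "(x, y) \<in> \<kappa>" "(y, z) \<in> \<kappa>" for x y z
    using Card_order_le_trans[OF assms(1) that] .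
  show ?thesis
  proof (cases "(a, b) \<in> \<kappa>")
    case True
    then have "\<forall>x\<in>A \<union> B. (x, b) \<in> \<kappa>"
      using a(2) b(2) trans[of _ a b] by auto
    then show ?thesis
      using b(1) unfolding bounded_in_def by auto
  next
    case False
    then have "(b, a) \<in> \<kappa>"
      using Card_order_not_le_iff[OF assms(1) a(1) b(1)] by simp
    then have "\<forall>x\<in>A \<union> B. (x, a) \<in> \<kappa>"
      using a(2) b(2) trans[of _ b a] by auto
    then show ?thesis
      using a(1) unfolding bounded_in_def by auto
  qed
qed

lemma ultrafilter_on_subset:
  assumes "ultrafilter_on X U" "A \<in> U"
  shows "A \<subseteq> X"
proof -
  have "U \<subseteq> Pow X"
    using assms(1) unfolding ultrafilter_on_def by (elim conjE)
  then show ?thesis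
    using assms(2) by blast
qed

lemma ultrafilter_on_cases:
  assumes "ultrafilter_on X U" "A \<subseteq> X"
  obtains "A \<in> U" | "X - A \<in> U"
proof -
  have "\<forall>A. A \<subseteq> X \<longrightarrow> A \<in> U \<or> X - A \<in> U"
    using assms(1) unfolding ultrafilter_on_def by (elim conjE)
  then show thesis
    using assms(2) that by auto
qed

section \<open>Boundedness, cardinality and regularity of \<open>\<kappa>\<close>\<close>

lemma Cinfinite_limit:
  assumes "Cinfinite \<kappa>" "a \<in> Field \<kappa>"
  obtains b where "b \<in> Field \<kappa>" "a \<noteq> b" "(a, b) \<in> \<kappa>"
proof -
  have "\<exists>b\<in>Field \<kappa>. a \<noteq> b \<and> (a, b) \<in> \<kappa>"
    using assms unfolding cinfinite_def by (intro infinite_Card_order_limit) simp_all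
  then show thesis
    using that by auto
qed

text \<open>An infinite cardinal has no last element, so a non-strict bound can be raised to a
  strict one. The set then lies in a proper initial segment, which has size below
  \<open>\<kappa>\<close>.\<close>

lemma bounded_in_ordLess:
  assumes "Cinfinite \<kappa>" "bounded_in \<kappa> A"
  shows "|A| <o \<kappa>"
proof -
  obtain b where b: "b \<in> Field \<kappa>" "\<And>a. a \<in> A \<Longrightarrow> (a, b) \<in> \<kappa>"
    using assms(2) unfolding bounded_in_def by blast
  obtain c where c: "c \<in> Field \<kappa>" "b \<noteq> c" "(b, c) \<in> \<kappa>"
    using Cinfinite_limit[OF assms(1) b(1)] .
  have "A \<subseteq> underS \<kappa> c"
  proof
    fix a assume "a \<in> A"
    then have "(a, b) \<in> \<kappa>" using b(2) by blast
    then show "a \<in> underS \<kappa> c"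
      using assms(1) c Card_order_le_trans[of \<kappa> a b c] Card_order_not_le_iff[of \<kappa> c b] b(1)
      unfolding underS_def by blast
  qed
  then show ?thesis
    using card_of_underS[of \<kappa> c] assms(1) c(1) card_of_mono1 ordLeq_ordLess_trans by blast
qed

text \<open>Bridge to the library notion in which \<open>regularCard\<close> is phrased: by
  totality, a point that is not below \<open>a\<close> is strictly above it, which is what
  \<open>cofinal\<close> demands.\<close>

lemma not_bounded_in_cofinal:
  assumes "Card_order \<kappa>" "A \<subseteq> Field \<kappa>" "\<not> bounded_in \<kappa> A"
  shows "cofinal A \<kappa>"
  unfolding cofinal_def
proof
  fix a assume a: "a \<in> Field \<kappa>"
  then obtain x where x: "x \<in> A" "(x, a) \<notin> \<kappa>"
    using assms(3) unfolding bounded_in_def by blast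
  then have "(a, x) \<in> \<kappa> \<and> x \<noteq> a"
    using Card_order_not_le_iff[OF assms(1) _ a] assms(2) by blast
  then show "\<exists>b\<in>A. a \<noteq> b \<and> (a, b) \<in> \<kappa>"
    using x(1) by auto
qed

lemma ordLess_bounded_in:
  assumes "Card_order \<kappa>" "regularCard \<kappa>" "A \<subseteq> Field \<kappa>" "|A| <o \<kappa>"
  shows "bounded_in \<kappa> A"
proof (rule ccontr)
  assume "\<not> bounded_in \<kappa> A"
  then have "|A| =o \<kappa>"
    using assms(2,3) not_bounded_in_cofinal[OF assms(1,3)] unfolding regularCard_def by simp
  then show False
    using assms(4) not_ordLess_ordIso by blast
qed

text \<open>Instead of taking a supremum of bounds, the argument passes through cardinalities:
  bounded sets have size below \<open>\<kappa>\<close>, regularity keeps the union that small, and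
  regularity again makes a small set bounded.\<close>

lemma bounded_in_UNION:
  assumes "Cinfinite \<kappa>" "regularCard \<kappa>" "|I| <o \<kappa>"
    and "\<And>i. i \<in> I \<Longrightarrow> bounded_in \<kappa> (A i)"
  shows "bounded_in \<kappa> (\<Union>i\<in>I. A i)"
proof (rule ordLess_bounded_in)
  show "(\<Union>i\<in>I. A i) \<subseteq> Field \<kappa>"
    using assms(4) unfolding bounded_in_def by (blast intro: FieldI1)
  show "|\<Union>i\<in>I. A i| <o \<kappa>"
    by (rule regularCard_UNION_bound[OF assms(1-3)])
      (rule bounded_in_ordLess[OF assms(1) assms(4)])
qed (use assms in simp_all)

text \<open>Proper initial segments are too small to lie in a uniform \<open>U\<close>, so all final
  segments lie in \<open>U\<close>. The final segments starting at the points of a cofinal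
  \<open>K\<close> have empty intersection, so completeness forbids \<open>K\<close> to have size
  below \<open>\<kappa>\<close>.\<close>

lemma uniform_complete_ultrafilter_regularCard:
  assumes inf: "Cinfinite \<kappa>" and uf: "ultrafilter_on (Field \<kappa>) U"
    and unif: "uniform_filter \<kappa> U" and compl: "complete_filter \<kappa> U"
  shows "regularCard \<kappa>"
  unfolding regularCard_def
proof (intro allI impI)
  fix K assume K: "K \<subseteq> Field \<kappa> \<and> cofinal K \<kappa>"
  have co: "Field \<kappa> - underS \<kappa> k \<in> U" if "k \<in> K" for k
  proof -
    have "|underS \<kappa> k| <o \<kappa>"
      by (rule card_of_underS) (use K that inf in auto)
    then have "underS \<kappa> k \<notin> U"
      using unif not_ordLess_ordIso unfolding uniform_filter_def by blast
    moreover have "underS \<kappa> k \<subseteq> Field \<kappa>"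
      unfolding underS_def by (blast intro: FieldI1)
    ultimately show ?thesis
      using ultrafilter_on_cases[OF uf] by auto
  qed
  have notless: "\<not> |K| <o \<kappa>"
  proof
    assume "|K| <o \<kappa>"
    then have "|(\<lambda>k. Field \<kappa> - underS \<kappa> k) ` K| <o \<kappa>"
      by (rule ordLeq_ordLess_trans[OF card_of_image])
    moreover have "(\<lambda>k. Field \<kappa> - underS \<kappa> k) ` K \<subseteq> U"
      using co by blast
    ultimately have "Field \<kappa> \<inter> \<Inter>((\<lambda>k. Field \<kappa> - underS \<kappa> k) ` K) \<in> U"
      using compl unfolding complete_filter_def by (metis (no_types))
    moreover have "Field \<kappa> \<inter> \<Inter>((\<lambda>k. Field \<kappa> - underS \<kappa> k) ` K) = {}"
    proof -
      have "a \<in> (\<Union>k\<in>K. underS \<kappa> k)" if a: "a \<in> Field \<kappa>" for a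
      proof -
        obtain k where "k \<in> K" "a \<noteq> k" "(a, k) \<in> \<kappa>"
          using K a unfolding cofinal_def by auto
        then show ?thesis
          unfolding underS_def by auto
      qed
      then show ?thesis by auto
    qed
    ultimately show False
      using uf unfolding ultrafilter_on_def by simp
  qed
  have "|K| \<le>o \<kappa>"
  proof -
    have "|K| \<le>o |Field \<kappa>|"
      using K by (intro card_of_mono1) simp
    moreover have "|Field \<kappa>| =o \<kappa>"
      using inf by (intro card_of_Field_ordIso) simp
    ultimately show ?thesis
      by (rule ordLeq_ordIso_trans)
  qed
  then have "|K| <o \<kappa> \<or> |K| =o \<kappa>"
    by (rule iffD1[OF ordLeq_iff_ordLess_or_ordIso])
  then show "|K| =o \<kappa>"
    by (elim disjE) (rule notE[OF notless])
qed

section \<open>Splitting infinite sets and decreasing families\<close>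

lemma infinite_split_ordIso:
  assumes "infinite R"
  obtains S T where "S \<subseteq> R" "T \<subseteq> R" "S \<inter> T = {}" "|S| =o |R|" "|T| =o |R|"
proof -
  have "|R <+> R| =o |R|"
    using assms card_of_Plus_infinite1 card_of_refl ordIso_imp_ordLeq by blast
  then obtain h where h: "bij_betw h (R <+> R) R"
    using card_of_ordIso by blast
  show thesis
  proof
    show "h ` Inl ` R \<subseteq> R" "h ` Inr ` R \<subseteq> R"
      using h unfolding bij_betw_def by auto
    show "h ` Inl ` R \<inter> h ` Inr ` R = {}"
      using h unfolding bij_betw_def inj_on_def by blast
    have "bij_betw (h \<circ> Inl) R (h ` Inl ` R)" "bij_betw (h \<circ> Inr) R (h ` Inr ` R)"
      using h unfolding bij_betw_def inj_on_def by (auto simp: image_comp)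
    then show "|h ` Inl ` R| =o |R|" "|h ` Inr ` R| =o |R|"
      using card_of_ordIso ordIso_symmetric by blast+
  qed
qed

text \<open>Let \<open>g n\<close> be the least index at which \<open>n\<close> has left the family.
  The range of \<open>g\<close> is unbounded, hence of size \<open>\<kappa>\<close> by regularity,
  and splits into two disjoint sets of size \<open>\<kappa>\<close>, which are again unbounded.
  Pulling one of them back along \<open>g\<close> gives \<open>Z\<close>.\<close>

lemma decreasing_family_split:
  assumes inf: "Cinfinite \<kappa>" and reg: "regularCard \<kappa>"
    and nonempty: "\<And>i. i \<in> Field \<kappa> \<Longrightarrow> N i \<inter> Field \<kappa> \<noteq> {}"
    and decr: "\<And>i j. (i, j) \<in> \<kappa> \<Longrightarrow> N j \<subseteq> N i"
    and empty: "\<And>n. n \<in> Field \<kappa> \<Longrightarrow> \<exists>i\<in>Field \<kappa>. n \<notin> N i"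
  obtains Z where "\<forall>i\<in>Field \<kappa>. N i \<inter> Z \<noteq> {}" "\<forall>i\<in>Field \<kappa>. N i - Z \<noteq> {}"
proof -
  have co: "Card_order \<kappa>" using inf by simp
  have "\<exists>m. m \<in> Field \<kappa> \<and> n \<notin> N m \<and> (\<forall>i\<in>Field \<kappa>. n \<notin> N i \<longrightarrow> (m, i) \<in> \<kappa>)"
    if "n \<in> Field \<kappa>" for n
  proof -
    have "{i \<in> Field \<kappa>. n \<notin> N i} \<noteq> {}" using empty[OF that] by blast
    then show ?thesis
      using Card_order_least[OF co, of "{i \<in> Field \<kappa>. n \<notin> N i}"]
      by (metis (no_types, lifting) mem_Collect_eq subsetI)
  qed
  then obtain g where g: "\<And>n. n \<in> Field \<kappa> \<Longrightarrow> g n \<in> Field \<kappa>"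
    and g_notin: "\<And>n. n \<in> Field \<kappa> \<Longrightarrow> n \<notin> N (g n)"
    and g_least: "\<And>n i. n \<in> Field \<kappa> \<Longrightarrow> i \<in> Field \<kappa> \<Longrightarrow> n \<notin> N i \<Longrightarrow> (g n, i) \<in> \<kappa>"
    by metis
  have "cofinal (g ` Field \<kappa>) \<kappa>"
  proof (rule not_bounded_in_cofinal[OF co])
    show "g ` Field \<kappa> \<subseteq> Field \<kappa>" using g by blast
    \<comment> \<open>If \<open>b\<close> were a bound, a point \<open>n\<close> of
      \<open>N b\<close> would also lie in the larger set \<open>N (g n)\<close>, which
      \<open>g\<close> excludes.\<close>
    show "\<not> bounded_in \<kappa> (g ` Field \<kappa>)"
    proof
      assume "bounded_in \<kappa> (g ` Field \<kappa>)"
      then obtain b where b: "b \<in> Field \<kappa>" "\<And>n. n \<in> Field \<kappa> \<Longrightarrow> (g n, b) \<in> \<kappa>"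
        unfolding bounded_in_def by blast
      obtain n where "n \<in> N b" "n \<in> Field \<kappa>"
        using nonempty[OF b(1)] by blast
      then show False
        using b(2) decr g_notin by blast
    qed
  qed
  then have card: "|g ` Field \<kappa>| =o \<kappa>"
    using reg g unfolding regularCard_def by blast
  then have "infinite (g ` Field \<kappa>)"
    using inf Cinfinite_cong[of \<kappa> "|g ` Field \<kappa>|"] ordIso_symmetric
    unfolding cinfinite_def by (metis Field_card_of)
  then obtain S T where ST: "S \<subseteq> g ` Field \<kappa>" "T \<subseteq> g ` Field \<kappa>" "S \<inter> T = {}"
    and "|S| =o |g ` Field \<kappa>|" "|T| =o |g ` Field \<kappa>|"
    using infinite_split_ordIso by blast
  then have "|S| =o \<kappa>" "|T| =o \<kappa>"
    using card ordIso_transitive by blast+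
  then have unbounded: "\<not> bounded_in \<kappa> S" "\<not> bounded_in \<kappa> T"
    using inf bounded_in_ordLess not_ordLess_ordIso by blast+
  \<comment> \<open>Some value \<open>g n\<close> in \<open>P\<close> is not below \<open>i\<close>.
    Then \<open>n\<close> is still in \<open>N i\<close>, since otherwise minimality would put
    \<open>g n\<close> below \<open>i\<close>.\<close>
  have meets: "\<exists>n\<in>Field \<kappa> \<inter> N i. g n \<in> P"
    if "i \<in> Field \<kappa>" "P \<subseteq> g ` Field \<kappa>" "\<not> bounded_in \<kappa> P" for i P
    using that g_least unfolding bounded_in_def by blast
  show thesis
  proof
    show "\<forall>i\<in>Field \<kappa>. N i \<inter> {n. g n \<in> S} \<noteq> {}"
      using meets[OF _ ST(1) unbounded(1)] by blast
    show "\<forall>i\<in>Field \<kappa>. N i - {n. g n \<in> S} \<noteq> {}"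
      using meets[OF _ ST(2) unbounded(2)] ST(3) by blast
  qed
qed

section \<open>The base indexed by \<open>D\<close>, and the contradiction\<close>

lemma simple_P_pointE:
  assumes "simple_P_point \<kappa> U D leD"
  obtains b where "\<forall>d\<in>D. b d \<in> U"
    and "\<forall>d\<in>D. \<forall>e\<in>D. (d, e) \<in> leD \<longleftrightarrow> almost_subset \<kappa> (b e) (b d)"
    and "\<forall>A\<in>U. \<exists>d\<in>D. almost_subset \<kappa> (b d) A"
proof -
  obtain \<B> \<phi> where \<B>: "\<B> \<subseteq> U" "\<And>A. A \<in> U \<Longrightarrow> \<exists>B\<in>\<B>. almost_subset \<kappa> B A"
    and bij: "bij_betw \<phi> \<B> D"
    and iso: "\<And>X Y. X \<in> \<B> \<Longrightarrow> Y \<in> \<B> \<Longrightarrow> almost_subset \<kappa> Y X \<longleftrightarrow> (\<phi> X, \<phi> Y) \<in> leD"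
    using assms unfolding simple_P_point_def order_isomorphic_def by auto
  \<comment> \<open>Inverting the isomorphism indexes the base by \<open>D\<close>, so that going up
    in \<open>leD\<close> means shrinking modulo bounded sets.\<close>
  let ?b = "inv_into \<B> \<phi>"
  have mem: "?b d \<in> \<B>" and right: "\<phi> (?b d) = d" if "d \<in> D" for d
    using bij that by (auto simp: bij_betw_def inv_into_into f_inv_into_f)
  have left: "?b (\<phi> X) = X" "\<phi> X \<in> D" if "X \<in> \<B>" for X
    using bij that by (auto simp: bij_betw_def)
  show thesis
  proof
    show "\<forall>d\<in>D. ?b d \<in> U"
      using \<B>(1) mem by blast
    show "\<forall>d\<in>D. \<forall>e\<in>D. (d, e) \<in> leD \<longleftrightarrow> almost_subset \<kappa> (?b e) (?b d)"
      using iso[OF mem mem] right by simp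
    show "\<forall>A\<in>U. \<exists>d\<in>D. almost_subset \<kappa> (?b d) A"
      using \<B>(2) left by metis
  qed
qed

theorem theorem2p2:
  fixes \<kappa> :: "'a rel" and U :: "'a set set"
    and D :: "'d set" and leD :: "'d rel"
  assumes "Cinfinite \<kappa>"
    and "ultrafilter_on (Field \<kappa>) U"
    and "uniform_filter \<kappa> U"
    and "complete_filter \<kappa> U"
    and "partial_order_on D leD"
    and "simple_P_point \<kappa> U D leD"
  shows "\<not> (\<exists>Ds :: 'a \<Rightarrow> 'd set.
            (\<forall>i\<in>Field \<kappa>. Ds i \<subseteq> D) \<and>
            (\<forall>i j. (i, j) \<in> \<kappa> \<longrightarrow> Ds i \<subseteq> Ds j) \<and>
            D = (\<Union>i\<in>Field \<kappa>. Ds i) \<and>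
            (\<forall>i\<in>Field \<kappa>. directed_for \<kappa> leD (Ds i) \<and> \<not> cofinal_in D leD (Ds i)))"
proof
  assume "\<exists>Ds :: 'a \<Rightarrow> 'd set.
            (\<forall>i\<in>Field \<kappa>. Ds i \<subseteq> D) \<and>
            (\<forall>i j. (i, j) \<in> \<kappa> \<longrightarrow> Ds i \<subseteq> Ds j) \<and>
            D = (\<Union>i\<in>Field \<kappa>. Ds i) \<and>
            (\<forall>i\<in>Field \<kappa>. directed_for \<kappa> leD (Ds i) \<and> \<not> cofinal_in D leD (Ds i))"
  then obtain Ds :: "'a \<Rightarrow> 'd set" where
    Ds: "\<forall>i\<in>Field \<kappa>. Ds i \<subseteq> D" "\<forall>i j. (i, j) \<in> \<kappa> \<longrightarrow> Ds i \<subseteq> Ds j"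
      "\<forall>i\<in>Field \<kappa>. directed_for \<kappa> leD (Ds i) \<and> \<not> cofinal_in D leD (Ds i)"
    and cover: "D = (\<Union>i\<in>Field \<kappa>. Ds i)"
    by (elim exE conjE)
  have sub: "Ds i \<subseteq> D" and dir: "directed_for \<kappa> leD (Ds i)"
    and noncof: "\<not> cofinal_in D leD (Ds i)" if "i \<in> Field \<kappa>" for i
    using Ds(1,3) that by simp_all
  have mono: "Ds i \<subseteq> Ds j" if "(i, j) \<in> \<kappa>" for i j
    using Ds(2) that by simp
  have co: "Card_order \<kappa>" using assms(1) by simp
  have reg: "regularCard \<kappa>"
    using uniform_complete_ultrafilter_regularCard[OF assms(1-4)] .
  obtain b where b_in: "\<forall>d\<in>D. b d \<in> U"
    and b_iso: "\<forall>d\<in>D. \<forall>e\<in>D. (d, e) \<in> leD \<longleftrightarrow> almost_subset \<kappa> (b e) (b d)"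
    and b_base: "\<forall>A\<in>U. \<exists>d\<in>D. almost_subset \<kappa> (b d) A"
    using simple_P_pointE[OF assms(6)] .
  have b_le: "(d, e) \<in> leD \<longleftrightarrow> almost_subset \<kappa> (b e) (b d)" if "d \<in> D" "e \<in> D" for d e
    using bspec[OF bspec[OF b_iso that(1)] that(2)] .
  have b_Field: "b d \<subseteq> Field \<kappa>" if "d \<in> D" for d
    using ultrafilter_on_subset[OF assms(2)] b_in that by simp
  \<comment> \<open>A point \<open>d\<close> witnessing that \<open>Ds i\<close> is not cofinal
    serves: through the isomorphism, no base set with index in \<open>Ds i\<close> is almost
    contained in \<open>b d\<close>.\<close>
  have "\<exists>d. d \<in> D \<and> (\<forall>e\<in>Ds i. \<not> almost_subset \<kappa> (b e) (b d))" if i: "i \<in> Field \<kappa>" for i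
  proof -
    obtain d where d: "d \<in> D" "\<forall>e\<in>Ds i. (d, e) \<notin> leD"
      using noncof[OF i] sub[OF i] unfolding cofinal_in_def by auto
    have "\<not> almost_subset \<kappa> (b e) (b d)" if e: "e \<in> Ds i" for e
      using b_le[OF d(1) subsetD[OF sub[OF i] e]] d(2) e by simp
    then show ?thesis using d(1) by auto
  qed
  then have "\<forall>i\<in>Field \<kappa>. \<exists>d. d \<in> D \<and> (\<forall>e\<in>Ds i. \<not> almost_subset \<kappa> (b e) (b d))"
    by (rule ballI)
  from bchoice[OF this] obtain c where
    c: "\<forall>i\<in>Field \<kappa>. c i \<in> D \<and> (\<forall>e\<in>Ds i. \<not> almost_subset \<kappa> (b e) (b (c i)))" ..
  \<comment> \<open>The alternative \<open>m = x\<close> provides a value even when \<open>x\<close>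
    lies in every \<open>b (c i)\<close>. It costs little, since it adds at most the point
    \<open>n\<close> to the fibre over \<open>n\<close>.\<close>
  have "\<exists>m. m \<in> Field \<kappa> \<and> (x \<notin> b (c m) \<or> m = x) \<and>
      (\<forall>i\<in>Field \<kappa>. x \<notin> b (c i) \<longrightarrow> (m, i) \<in> \<kappa>)" if "x \<in> Field \<kappa>" for x
  proof -
    let ?S = "{i \<in> Field \<kappa>. x \<notin> b (c i) \<or> i = x}"
    have "?S \<subseteq> Field \<kappa>" "?S \<noteq> {}" using that by auto
    then obtain m where "m \<in> ?S" "\<forall>s\<in>?S. (m, s) \<in> \<kappa>"
      by (rule Card_order_least[OF co])
    then show ?thesis by auto
  qed
  then have "\<forall>x\<in>Field \<kappa>. \<exists>m. m \<in> Field \<kappa> \<and> (x \<notin> b (c m) \<or> m = x) \<and>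
      (\<forall>i\<in>Field \<kappa>. x \<notin> b (c i) \<longrightarrow> (m, i) \<in> \<kappa>)"
    by (rule ballI)
  from bchoice[OF this] obtain f where
    f: "\<forall>x\<in>Field \<kappa>. f x \<in> Field \<kappa> \<and> (x \<notin> b (c (f x)) \<or> f x = x) \<and>
      (\<forall>i\<in>Field \<kappa>. x \<notin> b (c i) \<longrightarrow> (f x, i) \<in> \<kappa>)" ..
  then have f_fib: "x \<notin> b (c (f x)) \<or> f x = x"
    and f_least: "i \<in> Field \<kappa> \<Longrightarrow> x \<notin> b (c i) \<Longrightarrow> (f x, i) \<in> \<kappa>"
    if "x \<in> Field \<kappa>" for x i
    using that by auto
  define N where "N i = {n. \<forall>e\<in>Ds i. \<not> bounded_in \<kappa> (b e \<inter> {x. f x = n})}" for i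
  \<comment> \<open>Otherwise each \<open>n\<close> has some \<open>e n\<close> in
    \<open>Ds i\<close> whose base set is bounded on the fibre over \<open>n\<close>. An upper bound
    \<open>e'\<close> of fewer than \<open>\<kappa>\<close> of these will satisfy
    \<open>b e'\<close> almost contained in \<open>b (c i)\<close>, against the choice of
    \<open>c i\<close>.\<close>
  have nonempty: "N i \<inter> Field \<kappa> \<noteq> {}" if i: "i \<in> Field \<kappa>" for i
  proof
    assume "N i \<inter> Field \<kappa> = {}"
    then have "\<forall>n\<in>Field \<kappa>. \<exists>e. e \<in> Ds i \<and> bounded_in \<kappa> (b e \<inter> {x. f x = n})"
      unfolding N_def by auto
    from bchoice[OF this] obtain e where
      "\<forall>n\<in>Field \<kappa>. e n \<in> Ds i \<and> bounded_in \<kappa> (b (e n) \<inter> {x. f x = n})" ..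
    then have e: "e n \<in> Ds i" "bounded_in \<kappa> (b (e n) \<inter> {x. f x = n})" if "n \<in> Field \<kappa>" for n
      using that by auto
    \<comment> \<open>Only fibres with index up to \<open>i\<close> matter, because
      \<open>f x\<close> is at most \<open>i\<close> for every \<open>x\<close> outside
      \<open>b (c i)\<close>. This is what makes directedness for small sets sufficient.\<close>
    define I where "I = {n. (n, i) \<in> \<kappa>}"
    have I_Field: "I \<subseteq> Field \<kappa>"
      unfolding I_def by (blast intro: FieldI1)
    have "bounded_in \<kappa> I"
      unfolding I_def bounded_in_def using i by blast
    then have small: "|I| <o \<kappa>"
      by (rule bounded_in_ordLess[OF assms(1)])
    then have "|e ` I| <o \<kappa>"
      by (rule ordLeq_ordLess_trans[OF card_of_image])
    moreover have "e ` I \<subseteq> Ds i"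
      using e(1) I_Field by auto
    ultimately have "\<exists>e'\<in>Ds i. \<forall>s\<in>e ` I. (s, e') \<in> leD"
      using dir[OF i] unfolding directed_for_def by (metis (no_types))
    then obtain e' where e': "e' \<in> Ds i" "\<And>n. n \<in> I \<Longrightarrow> (e n, e') \<in> leD"
      by auto
    have e'_D: "e' \<in> D" using e'(1) sub[OF i] by blast
    have bd: "bounded_in \<kappa> ((b e' - b (e n)) \<union> (b (e n) \<inter> {x. f x = n}))" if "n \<in> I" for n
    proof -
      have n: "n \<in> Field \<kappa>" using that I_Field by blast
      have "bounded_in \<kappa> (b e' - b (e n))"
      proof -
        have "e n \<in> D" using e(1)[OF n] sub[OF i] by blast
        from b_le[OF this e'_D] show ?thesis
          using e'(2)[OF that] unfolding almost_subset_def by simp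
      qed
      then show ?thesis
        using bounded_in_Un[OF co] e(2)[OF n] by simp
    qed
    have "bounded_in \<kappa> (\<Union>n\<in>I. (b e' - b (e n)) \<union> (b (e n) \<inter> {x. f x = n}))"
      by (rule bounded_in_UNION[OF assms(1) reg small]) (rule bd)
    \<comment> \<open>A point \<open>x\<close> on the left falls into the piece for
      \<open>n = f x\<close>, by whether or not it belongs to \<open>b (e n)\<close>.\<close>
    moreover have "b e' - b (c i) \<subseteq> (\<Union>n\<in>I. (b e' - b (e n)) \<union> (b (e n) \<inter> {x. f x = n}))"
      using b_Field[OF e'_D] f_least[OF _ i] unfolding I_def by blast
    ultimately have "almost_subset \<kappa> (b e') (b (c i))"
      unfolding almost_subset_def by (rule bounded_in_mono)
    then show False using c i e'(1) by simp
  qed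
  have decr: "N j \<subseteq> N i" if "(i, j) \<in> \<kappa>" for i j
    using mono[OF that] unfolding N_def by blast
  have empty: "\<exists>i\<in>Field \<kappa>. n \<notin> N i" if n: "n \<in> Field \<kappa>" for n
  proof -
    \<comment> \<open>Since the \<open>Ds i\<close> exhaust \<open>D\<close>, the index
      \<open>c n\<close> itself appears in one of them and there witnesses that \<open>n\<close> is
      not in \<open>N i\<close>.\<close>
    obtain i where i: "i \<in> Field \<kappa>" "c n \<in> Ds i"
      using c n cover by auto
    \<comment> \<open>A point of \<open>b (c n)\<close> can receive the value \<open>n\<close> only
      through the alternative \<open>f x = x\<close>.\<close>
    have "b (c n) \<inter> {x. f x = n} \<subseteq> {n}"
    proof
      fix x assume x: "x \<in> b (c n) \<inter> {x. f x = n}"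
      then have "x \<in> Field \<kappa>"
        using b_Field[of "c n"] c n by auto
      then show "x \<in> {n}"
        using f_fib[of x] x by auto
    qed
    moreover obtain m where "m \<in> Field \<kappa>" "(n, m) \<in> \<kappa>"
      using Cinfinite_limit[OF assms(1) n] .
    then have "bounded_in \<kappa> {n}"
      unfolding bounded_in_def by auto
    ultimately have "bounded_in \<kappa> (b (c n) \<inter> {x. f x = n})"
      by (rule bounded_in_mono[rotated])
    then show ?thesis
      using i unfolding N_def by auto
  qed
  obtain Z where Z: "\<forall>i\<in>Field \<kappa>. N i \<inter> Z \<noteq> {}" "\<forall>i\<in>Field \<kappa>. N i - Z \<noteq> {}"
    using decreasing_family_split[OF assms(1) reg nonempty decr empty] .
  \<comment> \<open>A base set \<open>b d\<close> almost contained in \<open>A\<close> has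
    \<open>d\<close> in some \<open>Ds i\<close>. For \<open>n\<close> in \<open>N i\<close> it
    meets the fibre over \<open>n\<close> in an unbounded set, which the bounded
    \<open>b d - A\<close> cannot contain.\<close>
  have large: "\<exists>i\<in>Field \<kappa>. \<forall>n\<in>N i. \<exists>x\<in>A. f x = n" if A: "A \<in> U" for A
  proof -
    obtain d where d: "d \<in> D" "almost_subset \<kappa> (b d) A"
      using b_base A by blast
    obtain i where i: "i \<in> Field \<kappa>" "d \<in> Ds i"
      using d(1) cover by blast
    have "\<exists>x\<in>A. f x = n" if "n \<in> N i" for n
    proof (rule ccontr)
      assume "\<not> (\<exists>x\<in>A. f x = n)"
      then have "b d \<inter> {x. f x = n} \<subseteq> b d - A" by blast
      then have "bounded_in \<kappa> (b d \<inter> {x. f x = n})"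
        by (rule bounded_in_mono[OF d(2)[unfolded almost_subset_def]])
      then show False
        using i(2) that unfolding N_def by simp
    qed
    then show ?thesis using i(1) by blast
  qed
  \<comment> \<open>Whichever of \<open>?Y\<close> and its complement lies in \<open>U\<close>,
    \<open>large\<close> makes \<open>f\<close> map it onto a set containing some
    \<open>N i\<close>, but its values all stay on one side of \<open>Z\<close> while
    \<open>N i\<close> has points on both.\<close>
  let ?Y = "{x \<in> Field \<kappa>. f x \<in> Z}"
  have "?Y \<subseteq> Field \<kappa>" by blast
  with assms(2) show False
  proof (cases rule: ultrafilter_on_cases)
    case 1
    then obtain i where i: "i \<in> Field \<kappa>" "\<forall>n\<in>N i. \<exists>x\<in>?Y. f x = n"
      using large by blast
    obtain n where "n \<in> N i" "n \<notin> Z"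
      using Z(2) i(1) by blast
    then show False
      using i(2) by fastforce
  next
    case 2
    then obtain i where i: "i \<in> Field \<kappa>" "\<forall>n\<in>N i. \<exists>x\<in>Field \<kappa> - ?Y. f x = n"
      using large by blast
    obtain n where "n \<in> N i" "n \<in> Z"
      using Z(1) i(1) by blast
    then show False
      using i(2) by fastforce
  qed
qed

end
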